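(* Let $\lambda\in(0,1)$, let $Q=(\lambda^{|i-j|})_{i,j=1}^n\in\mathbb{R}^{n\times n}$ be the one-dimensional Wasserstein-1 metric matrix, and let $L\in\mathbb{R}^{n\times n}$ be its strictly lower triangular part. Then: (i) $\|Q\|_2\le n$. (ii) $\|L\|_2\le \sqrt{(n-2+\lambda^2)\left(1+\frac{\lambda^4-\lambda^{2n}}{1-\lambda^2}\right)}$. (iii) $\det(Q)=(1-\lambda^2)^{n-1}$.
   Context: Here $\lambda=e^{-h/\varepsilon}$ with $h,\varepsilon>0$, so $\lambda\in(0,1)$. $L=(l_{ij})$ has $l_{ij}=\lambda^{i-j}$ for $i>j$ and $l_{ij}=0$ otherwise, so that $Q=I+L+L^T$. $\|\cdot\|_2$ is the spectral norm (the operator norm induced by the Euclidean norm).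
   Formalization: Part (ii) is stated for n ≥ 2 only: for n = 1 the expression under the square root equals −(1−λ²)² < 0, so the claimed bound is undefined; parts (i) and (iii) hold for all n ≥ 1. *)

theory Defs
  imports
    "Jordan_Normal_Form.Determinant"
    "HOL-Analysis.L2_Norm"
begin

text \<open>
  Rows and columns are indexed from \<open>0\<close>; the entries of the matrix below depend only on
  the difference of the two indices, so this agrees with indexing by \<open>1, \<dots>, n\<close>.
\<close>

definition wasserstein1_mat :: "nat \<Rightarrow> real \<Rightarrow> real mat" where
  "wasserstein1_mat n lam = mat n n (\<lambda>(i, j). lam ^ nat \<bar>int i - int j\<bar>)"

definition strict_lower_part :: "'a :: zero mat \<Rightarrow> 'a mat" where
  "strict_lower_part A =
     mat (dim_row A) (dim_col A) (\<lambda>(i, j). if j < i then A $$ (i, j) else 0)"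

definition euclid_norm :: "real vec \<Rightarrow> real" where
  "euclid_norm v = L2_set (\<lambda>i. v $ i) {..<dim_vec v}"

text \<open>
  The operator norm induced by the Euclidean norm, in the form used for \<open>onorm\<close> in
  HOL-Analysis. The zero vector contributes the harmless value \<open>0 / 0 = 0\<close>. The supremum
  is a genuine one, by the lemma \<open>bdd_above_spectral_norm\<close> below.
\<close>

definition spectral_norm :: "real mat \<Rightarrow> real" where
  "spectral_norm A =
     (SUP v \<in> carrier_vec (dim_col A). euclid_norm (A *\<^sub>v v) / euclid_norm v)"

lemma bdd_above_spectral_norm:
  "bdd_above ((\<lambda>v. euclid_norm (A *\<^sub>v v) / euclid_norm v) ` carrier_vec (dim_col A))"
proof (rule bdd_aboveI2)
  fix v :: "real vec"
  assume v: "v \<in> carrier_vec (dim_col A)"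
  let ?M = "\<Sum>i<dim_row A. L2_set (\<lambda>j. A $$ (i, j)) {..<dim_col A}"
  have entry: "\<bar>(A *\<^sub>v v) $ i\<bar> \<le> L2_set (\<lambda>j. A $$ (i, j)) {..<dim_col A} * euclid_norm v"
    if i: "i < dim_row A" for i
  proof -
    have "(A *\<^sub>v v) $ i = (\<Sum>j<dim_col A. A $$ (i, j) * v $ j)"
      using i v by (auto simp: scalar_prod_def atLeast0LessThan intro!: sum.cong)
    also have "\<bar>\<dots>\<bar> \<le> (\<Sum>j<dim_col A. \<bar>A $$ (i, j)\<bar> * \<bar>v $ j\<bar>)"
      by (rule order_trans[OF sum_abs]) (simp add: abs_mult)
    also have "\<dots> \<le> L2_set (\<lambda>j. A $$ (i, j)) {..<dim_col A} * euclid_norm v"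
      using L2_set_mult_ineq[of "\<lambda>j. A $$ (i, j)" "\<lambda>j. v $ j" "{..<dim_col A}"] v
      by (simp add: euclid_norm_def)
    finally show ?thesis .
  qed
  have "euclid_norm (A *\<^sub>v v) \<le> (\<Sum>i<dim_row A. \<bar>(A *\<^sub>v v) $ i\<bar>)"
    unfolding euclid_norm_def using L2_set_le_sum_abs[of "\<lambda>i. (A *\<^sub>v v) $ i" "{..<dim_row A}"]
    by simp
  also have "\<dots> \<le> ?M * euclid_norm v"
    unfolding sum_distrib_right by (rule sum_mono) (use entry in simp)
  finally have "euclid_norm (A *\<^sub>v v) \<le> ?M * euclid_norm v" .
  moreover have "0 \<le> euclid_norm v" "0 \<le> ?M"
    by (auto simp: euclid_norm_def intro!: sum_nonneg L2_set_nonneg)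
  ultimately show "euclid_norm (A *\<^sub>v v) / euclid_norm v \<le> ?M"
    by (cases "euclid_norm v = 0") (auto simp: divide_le_eq)
qed

lemma wasserstein1_mat_split:
  "wasserstein1_mat n lam =
     1\<^sub>m n + strict_lower_part (wasserstein1_mat n lam)
       + transpose_mat (strict_lower_part (wasserstein1_mat n lam))"
  by (rule eq_matI) (auto simp: wasserstein1_mat_def strict_lower_part_def abs_minus_commute)

end

theory Submission
  imports Defs
begin

text \<open>
  Both norm estimates already hold for the Frobenius norm, which dominates the spectral norm.
  The determinant comes from a factorization of the metric matrix into a unit lower triangular
  factor and an upper triangular one with diagonal \<open>1, 1 - \<lambda>\<^sup>2, \<dots>, 1 - \<lambda>\<^sup>2\<close>.
\<close>

text \<open>Cauchy-Schwarz on each row bounds that coordinate of the product by the row norm times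
  \<open>euclid_norm v\<close>; squaring and adding over the rows gives the Frobenius norm of
  \<open>A\<close>.\<close>

lemma euclid_norm_mult_mat_vec_le:
  assumes v: "v \<in> carrier_vec (dim_col A)"
  shows "euclid_norm (A *\<^sub>v v)
    \<le> sqrt (\<Sum>i<dim_row A. \<Sum>j<dim_col A. (A $$ (i, j))\<^sup>2) * euclid_norm v"
proof -
  have row: "\<bar>(A *\<^sub>v v) $ i\<bar> \<le> L2_set (\<lambda>j. A $$ (i, j)) {..<dim_col A} * euclid_norm v"
    if i: "i < dim_row A" for i
  proof -
    have "(A *\<^sub>v v) $ i = (\<Sum>j<dim_col A. A $$ (i, j) * v $ j)"
      using i v by (auto simp: scalar_prod_def atLeast0LessThan intro!: sum.cong)
    also have "\<bar>\<dots>\<bar> \<le> (\<Sum>j<dim_col A. \<bar>A $$ (i, j)\<bar> * \<bar>v $ j\<bar>)"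
      by (rule order_trans[OF sum_abs]) (simp add: abs_mult)
    also have "\<dots> \<le> L2_set (\<lambda>j. A $$ (i, j)) {..<dim_col A} * euclid_norm v"
      using L2_set_mult_ineq[of "\<lambda>j. A $$ (i, j)" "\<lambda>j. v $ j" "{..<dim_col A}"] v
      by (simp add: euclid_norm_def)
    finally show ?thesis .
  qed
  have "(\<Sum>i<dim_row A. ((A *\<^sub>v v) $ i)\<^sup>2)
      \<le> (\<Sum>i<dim_row A. (L2_set (\<lambda>j. A $$ (i, j)) {..<dim_col A} * euclid_norm v)\<^sup>2)"
    by (intro sum_mono abs_le_square_iff[THEN iffD1] order_trans[OF row abs_ge_self]) simp
  also have "\<dots> = (\<Sum>i<dim_row A. \<Sum>j<dim_col A. (A $$ (i, j))\<^sup>2) * (euclid_norm v)\<^sup>2"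
    by (simp add: power_mult_distrib sum_distrib_right L2_set_def sum_nonneg)
  finally have "sqrt (\<Sum>i<dim_row A. ((A *\<^sub>v v) $ i)\<^sup>2)
      \<le> sqrt ((\<Sum>i<dim_row A. \<Sum>j<dim_col A. (A $$ (i, j))\<^sup>2) * (euclid_norm v)\<^sup>2)"
    by (rule real_sqrt_le_mono)
  then show ?thesis
    by (simp add: euclid_norm_def[of "A *\<^sub>v v"] L2_set_def real_sqrt_mult)
      (simp add: euclid_norm_def)
qed

lemma spectral_norm_le_Frobenius:
  "spectral_norm A \<le> sqrt (\<Sum>i<dim_row A. \<Sum>j<dim_col A. (A $$ (i, j))\<^sup>2)"
  unfolding spectral_norm_def
proof (rule cSUP_least)
  show "carrier_vec (dim_col A) \<noteq> ({} :: real vec set)"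
    using zero_carrier_vec by blast
next
  fix v :: "real vec"
  assume v: "v \<in> carrier_vec (dim_col A)"
  have "0 \<le> euclid_norm v"
    by (simp add: euclid_norm_def L2_set_nonneg)
  \<comment> \<open>If \<open>euclid_norm v = 0\<close>, division by zero makes the quotient 0, and
    only nonnegativity of the bound is left to check.\<close>
  then show "euclid_norm (A *\<^sub>v v) / euclid_norm v
      \<le> sqrt (\<Sum>i<dim_row A. \<Sum>j<dim_col A. (A $$ (i, j))\<^sup>2)"
    using euclid_norm_mult_mat_vec_le[OF v]
    by (cases "euclid_norm v = 0") (auto simp: divide_le_eq intro!: sum_nonneg)
qed

text \<open>All entries lie in [0, 1], so the \<open>n * n\<close> squared entries add up to at most
  the square of \<open>n\<close>.\<close>

lemma spectral_norm_wasserstein1_mat_le: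
  assumes "0 \<le> lam" "lam \<le> 1"
  shows "spectral_norm (wasserstein1_mat n lam) \<le> real n"
proof -
  have "(\<Sum>i<n. \<Sum>j<n. (wasserstein1_mat n lam $$ (i, j))\<^sup>2) \<le> (\<Sum>i<n. \<Sum>j<n. 1)"
    using assms by (intro sum_mono) (simp add: wasserstein1_mat_def power_le_one)
  then have "sqrt (\<Sum>i<n. \<Sum>j<n. (wasserstein1_mat n lam $$ (i, j))\<^sup>2) \<le> real n"
    by (intro real_le_lsqrt) (auto simp: power2_eq_square intro!: sum_nonneg)
  then show ?thesis
    using spectral_norm_le_Frobenius[of "wasserstein1_mat n lam"]
    by (simp add: wasserstein1_mat_def)
qed

lemma sum_square_row_strict_lower_part_wasserstein1_mat:
  assumes "i < n"
  shows "(\<Sum>j<n. (strict_lower_part (wasserstein1_mat n lam) $$ (i, j))\<^sup>2)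
    = (\<Sum>k=1..i. (lam\<^sup>2) ^ k)"
proof -
  have "(\<Sum>j<n. (strict_lower_part (wasserstein1_mat n lam) $$ (i, j))\<^sup>2)
      = (\<Sum>j<n. if j < i then (lam\<^sup>2) ^ (i - j) else 0)"
    using assms
    by (intro sum.cong)
      (auto simp: strict_lower_part_def wasserstein1_mat_def power_mult[symmetric] mult.commute
        nat_diff_distrib simp flip: of_nat_diff)
  also have "\<dots> = (\<Sum>j<i. (lam\<^sup>2) ^ (i - j))"
    using assms by (intro sum.mono_neutral_cong_right) auto
  also have "\<dots> = (\<Sum>k=1..i. (lam\<^sup>2) ^ k)"
    by (rule sum.reindex_bij_witness[of _ "\<lambda>k. i - k" "\<lambda>j. i - j"]) auto
  finally show ?thesis .
qed

text \<open>With \<open>x\<close> the square of \<open>lam\<close> and \<open>m + 2\<close> the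
  matrix size, the left side is the squared Frobenius norm of the strictly lower part. Both sides
  equal \<open>x\<close> at \<open>m = 0\<close>, and each further row raises the right side by at
  least as much as the left.\<close>

lemma sum_row_geometric_sums_le:
  fixes x :: real
  assumes "0 \<le> x" "x \<le> 1"
  shows "(\<Sum>i<m + 2. \<Sum>k=1..i. x ^ k) \<le> (real m + x) * (1 + (\<Sum>k=2..<m + 2. x ^ k))"
proof (induction m)
  case 0
  show ?case by (simp add: numeral_2_eq_2)
next
  case (Suc m)
  let ?S = "\<Sum>k=2..<m + 2. x ^ k"
  have "(\<Sum>i<Suc m + 2. \<Sum>k=1..i. x ^ k)
      = (\<Sum>i<m + 2. \<Sum>k=1..i. x ^ k) + (\<Sum>k=1..m + 2. x ^ k)"
    by simp
  also have "(\<Sum>k=1..m + 2. x ^ k) = x + ?S + x ^ (m + 2)"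
    by (simp add: sum.atLeast_Suc_atMost atLeastLessThanSuc_atLeastAtMost numeral_2_eq_2)
  also have "(\<Sum>i<m + 2. \<Sum>k=1..i. x ^ k) \<le> (real m + x) * (1 + ?S)"
    by (rule Suc.IH)
  \<comment> \<open>The slack added here is \<open>1 - x\<close> and
    \<open>(real m + x) * x ^ (m + 2)\<close>, chosen so that the result is the expanded right side
    for \<open>Suc m\<close>.\<close>
  also have "(real m + x) * (1 + ?S) + (x + ?S + x ^ (m + 2))
      \<le> (real m + x) * (1 + ?S) + (1 + ?S + x ^ (m + 2)) + (real m + x) * x ^ (m + 2)"
  proof -
    have "0 \<le> (real m + x) * x ^ (m + 2)"
      using assms by simp
    then show ?thesis
      using assms(2) by linarith
  qed
  also have "\<dots> = (real (Suc m) + x) * (1 + (\<Sum>k=2..<Suc m + 2. x ^ k))"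
    by (simp add: algebra_simps)
  finally show ?case by simp
qed

text \<open>The case \<open>n = 1\<close> has to be excluded: there the radicand is minus the square
  of 1 - lam^2, \<open>sqrt\<close> of it is negative, and the norm of the zero matrix is 0.\<close>

lemma spectral_norm_strict_lower_part_wasserstein1_mat_le:
  assumes lam: "0 \<le> lam" "lam < 1" and n: "2 \<le> n"
  shows "spectral_norm (strict_lower_part (wasserstein1_mat n lam))
    \<le> sqrt ((real n - 2 + lam\<^sup>2) * (1 + (lam ^ 4 - lam ^ (2 * n)) / (1 - lam\<^sup>2)))"
proof -
  let ?L = "strict_lower_part (wasserstein1_mat n lam)"
  have dim: "dim_row ?L = n" "dim_col ?L = n"
    by (simp_all add: strict_lower_part_def wasserstein1_mat_def)
  have sq: "lam\<^sup>2 < 1"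
    using lam by (simp add: power_less_one_iff)
  have "(\<Sum>i<n. \<Sum>j<n. (?L $$ (i, j))\<^sup>2) = (\<Sum>i<n. \<Sum>k=1..i. (lam\<^sup>2) ^ k)"
    by (intro sum.cong refl sum_square_row_strict_lower_part_wasserstein1_mat) simp
  also have "\<dots> \<le> (real n - 2 + lam\<^sup>2) * (1 + (\<Sum>k=2..<n. (lam\<^sup>2) ^ k))"
  proof -
    obtain m where "n = m + 2"
      using n by (metis le_add_diff_inverse2)
    then show ?thesis
      using sum_row_geometric_sums_le[of "lam\<^sup>2" m] sq by (simp only:) simp
  qed
  also have "(\<Sum>k=2..<n. (lam\<^sup>2) ^ k) = (lam ^ 4 - lam ^ (2 * n)) / (1 - lam\<^sup>2)"
  proof -
    \<comment> \<open>The sum telescopes after multiplication by \<open>1 - x\<close>; at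
      \<open>n = 2\<close> it is empty and both sides vanish.\<close>
    have "(1 - x) * (\<Sum>k=2..<n. x ^ k) = x\<^sup>2 - x ^ n" for x :: real
      using n by (induction n rule: dec_induct) (simp_all add: distrib_left left_diff_distrib)
    from this[of "lam\<^sup>2"] show ?thesis
      using sq by (simp add: eq_divide_eq power_mult mult.commute[of _ "1 - lam\<^sup>2"])
  qed
  finally show ?thesis
    by (intro order_trans[OF spectral_norm_le_Frobenius] real_sqrt_le_mono) (simp add: dim)
qed

text \<open>This is I + L, with L the strictly lower part of the metric matrix.\<close>

definition toeplitz_lower_factor :: "nat \<Rightarrow> real \<Rightarrow> real mat" where
  "toeplitz_lower_factor n lam = mat n n (\<lambda>(i, k). if k \<le> i then lam ^ (i - k) else 0)"

text \<open>This is D (I + L)^T with D = diag(1, 1 - lam^2, ..., 1 - lam^2), so the factorization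
  below is an LDL^T decomposition.\<close>

definition toeplitz_upper_factor :: "nat \<Rightarrow> real \<Rightarrow> real mat" where
  "toeplitz_upper_factor n lam =
     mat n n (\<lambda>(k, j). if k \<le> j then (if k = 0 then 1 else 1 - lam\<^sup>2) * lam ^ (j - k) else 0)"

text \<open>Here \<open>a\<close> and \<open>b\<close> stand for the distances of the row and column
  index from their minimum \<open>m\<close>. They vary in the induction because the terms up to
  \<open>m\<close> of the sum for \<open>Suc m\<close> form the sum for \<open>m\<close> with both
  offsets raised by one. They give lam^(a+b+2), and the last term (1 - lam^2) lam^(a+b) restores
  lam^(a+b).\<close>

lemma sum_toeplitz_factors:
  fixes lam :: real
  shows "(\<Sum>k\<le>m. lam ^ (m + a - k) * ((if k = 0 then 1 else 1 - lam\<^sup>2) * lam ^ (m + b - k)))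
    = lam ^ (a + b)"
proof (induction m arbitrary: a b)
  case 0
  show ?case by (simp add: power_add)
next
  case (Suc m)
  then show ?case
    using Suc.IH[of "Suc a" "Suc b"] by (simp add: power_add algebra_simps power2_eq_square)
qed

lemma wasserstein1_mat_factorization:
  "wasserstein1_mat n lam = toeplitz_lower_factor n lam * toeplitz_upper_factor n lam"
proof (rule eq_matI)
  fix i j
  assume "i < dim_row (toeplitz_lower_factor n lam * toeplitz_upper_factor n lam)"
    and "j < dim_col (toeplitz_lower_factor n lam * toeplitz_upper_factor n lam)"
  then have ij: "i < n" "j < n"
    by (simp_all add: toeplitz_lower_factor_def toeplitz_upper_factor_def)
  \<comment> \<open>Beyond \<open>m\<close> one of the two triangular factors contributes a zero, so
    the product sum stops at \<open>m\<close>.\<close>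
  define m where "m = min i j"
  have m: "i = m + (i - m)" "j = m + (j - m)" "m < n"
    using ij by (auto simp: m_def)
  have "(toeplitz_lower_factor n lam * toeplitz_upper_factor n lam) $$ (i, j)
      = (\<Sum>k<n. (if k \<le> i then lam ^ (i - k) else 0) *
          (if k \<le> j then (if k = 0 then 1 else 1 - lam\<^sup>2) * lam ^ (j - k) else 0))"
    using ij
    by (auto simp: toeplitz_lower_factor_def toeplitz_upper_factor_def scalar_prod_def
        atLeast0LessThan intro!: sum.cong)
  also have "\<dots> = (\<Sum>k\<le>m. lam ^ (m + (i - m) - k) *
      ((if k = 0 then 1 else 1 - lam\<^sup>2) * lam ^ (m + (j - m) - k)))"
    using m(3) by (intro sum.mono_neutral_cong_right) (auto simp: m_def)
  also have "\<dots> = lam ^ ((i - m) + (j - m))"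
    by (rule sum_toeplitz_factors)
  \<comment> \<open>One of the two offsets is 0 and the other is the distance between
    \<open>i\<close> and \<open>j\<close>.\<close>
  also have "(i - m) + (j - m) = nat \<bar>int i - int j\<bar>"
    by (auto simp: m_def min_def)
  finally show "wasserstein1_mat n lam $$ (i, j)
      = (toeplitz_lower_factor n lam * toeplitz_upper_factor n lam) $$ (i, j)"
    using ij by (simp add: wasserstein1_mat_def)
qed (simp_all add: wasserstein1_mat_def toeplitz_lower_factor_def toeplitz_upper_factor_def)

lemma det_toeplitz_lower_factor: "det (toeplitz_lower_factor n lam) = 1"
  by (subst det_lower_triangular[where n = n])
    (auto simp: toeplitz_lower_factor_def prod_list_diag_prod)

lemma det_toeplitz_upper_factor:
  assumes "1 \<le> n"
  shows "det (toeplitz_upper_factor n lam) = (1 - lam\<^sup>2) ^ (n - 1)"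
proof -
  have "det (toeplitz_upper_factor n lam) = (\<Prod>k=0..<n. if k = 0 then 1 else 1 - lam\<^sup>2)"
    by (subst det_upper_triangular[where n = n])
      (auto simp: toeplitz_upper_factor_def prod_list_diag_prod intro!: prod.cong)
  also have "\<dots> = (1 - lam\<^sup>2) ^ (n - 1)"
    using assms by (simp add: prod.atLeast_Suc_lessThan)
  finally show ?thesis .
qed

lemma det_wasserstein1_mat:
  assumes "1 \<le> n"
  shows "det (wasserstein1_mat n lam) = (1 - lam\<^sup>2) ^ (n - 1)"
  using assms unfolding wasserstein1_mat_factorization
  by (subst det_mult[where n = n])
    (auto simp: det_toeplitz_lower_factor det_toeplitz_upper_factor,
     simp_all add: toeplitz_lower_factor_def toeplitz_upper_factor_def)

theorem theorem3p3:
  fixes lam :: real and n :: nat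
  assumes "0 < lam" and "lam < 1" and "1 \<le> n"
  shows "spectral_norm (wasserstein1_mat n lam) \<le> real n \<and>
    (2 \<le> n \<longrightarrow>
       spectral_norm (strict_lower_part (wasserstein1_mat n lam))
         \<le> sqrt ((real n - 2 + lam\<^sup>2) * (1 + (lam ^ 4 - lam ^ (2 * n)) / (1 - lam\<^sup>2)))) \<and>
    det (wasserstein1_mat n lam) = (1 - lam\<^sup>2) ^ (n - 1)"
  using assms by (simp add: spectral_norm_wasserstein1_mat_le
      spectral_norm_strict_lower_part_wasserstein1_mat_le det_wasserstein1_mat)

end
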